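(* Let $p$ be prime, $\mathcal{A}=\mathbb{Z}/p$ and $D\ge1$. Then every nontrivial linear cellular automaton on $\mathcal{A}^{\mathbb{Z}^D}$ is diffusive in density.
   Context: For $\vec m\in\mathbb{Z}^D$, $(\sigma^{\vec m}\mathbf{a})_{\vec n}=a_{\vec m+\vec n}$. Every LCA on $\mathcal{A}^{\mathbb{Z}^D}$ has the form $\mathfrak{F}=\sum_{\vec u\in U}f_{\vec u}\sigma^{\vec u}$ with $U$ finite, $f_{\vec u}\in\mathbb{Z}/p$; it is nontrivial if at least two of the coefficients $f_{\vec u}$ are nonzero. Characters of $\mathcal{A}^{\mathbb{Z}^D}$ are $\chi=\bigotimes_{\vec n}\chi_{\vec n}$ with $\chi_{\vec n}$ characters of $\mathcal{A}$, all but finitely many trivial; rank$(\chi)$ is the number of nontrivial $\chi_{\vec n}$. $\mathfrak{F}$ is diffusive in density if for every nontrivial character $\chi$ there is $J_\chi\subset\mathbb{N}$ of Cesàro density 1 (i.e. $|J_\chi\cap[1,N]|/N\to1$) such that rank$(\chi\circ\mathfrak{F}^j)\to\infty$ as $j\to\infty$, $j\in J_\chi$. *)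

theory Defs
  imports "HOL-Analysis.Analysis"
begin

text \<open>The alphabet Z/p is represented by the integers {0..<p} with arithmetic mod p.
  The lattice Z^D is the type int^'d for a finite (nonempty) index type 'd with CARD('d) = D.
  A configuration is a map (int^'d) \<Rightarrow> int with values in {0..<p}.\<close>

definition configs :: "int \<Rightarrow> ((int^'d) \<Rightarrow> int) set" where
  "configs p = {a. \<forall>n. a n \<in> {0..<p}}"

definition lca :: "int \<Rightarrow> (int^'d) set \<Rightarrow> ((int^'d) \<Rightarrow> int)
                    \<Rightarrow> ((int^'d) \<Rightarrow> int) \<Rightarrow> ((int^'d) \<Rightarrow> int)" where
  "lca p U f a = (\<lambda>n. (\<Sum>u\<in>U. f u * a (u + n)) mod p)"

definition nontrivial_lca :: "int \<Rightarrow> (int^'d) set \<Rightarrow> ((int^'d) \<Rightarrow> int) \<Rightarrow> bool" where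
  "nontrivial_lca p U f \<longleftrightarrow> card {u\<in>U. f u mod p \<noteq> 0} \<ge> 2"

text \<open>Characters of Z/p are x \<mapsto> exp(2 pi i k x / p), k in {0..<p}; k = 0 is the trivial one.
  A character of the full shift is a tensor product of such, all but finitely many trivial;
  it is described by its finitely supported index function c.\<close>
definition char_coeffs :: "int \<Rightarrow> ((int^'d) \<Rightarrow> int) set" where
  "char_coeffs p = {c. (\<forall>n. c n \<in> {0..<p}) \<and> finite {n. c n \<noteq> 0}}"

definition chr :: "int \<Rightarrow> ((int^'d) \<Rightarrow> int) \<Rightarrow> ((int^'d) \<Rightarrow> int) \<Rightarrow> complex" where
  "chr p c a = (\<Prod>n\<in>{n. c n \<noteq> 0}. cis (2 * pi * real_of_int (c n * a n) / real_of_int p))"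

definition char_index :: "int \<Rightarrow> (((int^'d) \<Rightarrow> int) \<Rightarrow> complex) \<Rightarrow> ((int^'d) \<Rightarrow> int)" where
  "char_index p g = (THE c. c \<in> char_coeffs p \<and> (\<forall>a\<in>configs p. g a = chr p c a))"

definition char_rank :: "int \<Rightarrow> (((int^'d) \<Rightarrow> int) \<Rightarrow> complex) \<Rightarrow> nat" where
  "char_rank p g = card {n. char_index p g n \<noteq> 0}"

definition diffusive_in_density ::
  "int \<Rightarrow> (((int^'d) \<Rightarrow> int) \<Rightarrow> ((int^'d) \<Rightarrow> int)) \<Rightarrow> bool" where
  "diffusive_in_density p F \<longleftrightarrow>
     (\<forall>c\<in>char_coeffs p. c \<noteq> (\<lambda>_. 0) \<longrightarrow>
        (\<exists>J::nat set.
           (\<lambda>N. real (card (J \<inter> {1..N})) / real N) \<longlonglongrightarrow> 1 \<and>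
           (\<forall>M. \<exists>j0. \<forall>j\<in>J. j \<ge> j0 \<longrightarrow> char_rank p (\<lambda>a. chr p c ((F ^^ j) a)) \<ge> M)))"

end

theory Submission
  imports Defs "HOL-Computational_Algebra.Polynomial" "HOL-Computational_Algebra.Primes"
begin

text \<open>
  Composing the character with index \<open>c\<close> with the \<open>j\<close>-th iterate of the automaton multiplies the Laurent
  polynomial of \<open>c\<close> by the \<open>j\<close>-th power of the Laurent polynomial of the automaton, so the rank is the
  number of coefficients of a product \<open>C * F ^ j\<close> that do not vanish modulo \<open>p\<close>. An additive map from
  \<open>\<int>\<^sup>D\<close> to \<open>\<int>\<close> that is injective on the supports can only lower this number and reduces
  the claim to one variable. For a power \<open>q\<close> of \<open>p\<close> exceeding the degrees, the Frobenius congruence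
  between \<open>F ^ q\<close> and \<open>F (x ^ q)\<close> shows that every digit 1 of \<open>j\<close> in base \<open>q\<close> at least doubles the
  number of terms. Almost all \<open>j\<close> have many such digits, because the sum of \<open>2 ^ (- v j)\<close> over
  \<open>j < q ^ n\<close>, with \<open>v j\<close> the number of digits 1, is exactly \<open>(q - 1/2) ^ n\<close>.
\<close>

subsection \<open>Powers of integer polynomials modulo a prime\<close>

text \<open>The inner binomial coefficients are multiples of \<open>p\<close>. Congruences are
  written as divisibility by \<open>of_nat p\<close>, so that all arguments stay in
  \<open>int poly\<close> without a quotient ring.\<close>

lemma freshmans_dream_dvd:
  fixes x y :: "'a::comm_ring_1"
  assumes "prime (p::nat)"
  shows "of_nat p dvd (x + y) ^ p - x ^ p - y ^ p"
proof -
  have p: "p > 0" using assms by (simp add: prime_gt_0_nat)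
  have "(x + y) ^ p = (\<Sum>k\<le>p. of_nat (p choose k) * x ^ k * y ^ (p - k))"
    by (rule binomial_ring)
  also have "{..p} = insert 0 (insert p {0<..<p})" using p by auto
  also have "(\<Sum>k\<in>\<dots>. of_nat (p choose k) * x ^ k * y ^ (p - k))
     = y ^ p + x ^ p + (\<Sum>k\<in>{0<..<p}. of_nat (p choose k) * x ^ k * y ^ (p - k))"
    using p by (simp add: algebra_simps)
  finally have eq: "(x + y) ^ p - x ^ p - y ^ p = (\<Sum>k\<in>{0<..<p}. of_nat (p choose k) * x ^ k * y ^ (p - k))"
    by simp
  have "of_nat p dvd (of_nat (p choose k) * x ^ k * y ^ (p - k))" if "k \<in> {0<..<p}" for k
  proof -
    have "p dvd (p choose k)" using that assms by (intro dvd_choose_prime) auto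
    then have "(of_nat p :: 'a) dvd of_nat (p choose k)" by (metis dvd_def of_nat_mult)
    then show ?thesis by (simp add: dvd_mult2)
  qed
  then show ?thesis unfolding eq by (rule dvd_sum)
qed

lemma dvd_power_diff_power:
  fixes a b :: "'a::comm_ring_1"
  assumes "d dvd a - b"
  shows "d dvd a ^ n - b ^ n"
proof -
  have "a - b dvd a ^ n - b ^ n" by (simp add: power_diff_sumr2)
  with assms show ?thesis by (rule dvd_trans)
qed

lemma freshmans_dream_prime_power_dvd:
  fixes x y :: "'a::comm_ring_1"
  assumes "prime (p::nat)"
  shows "of_nat p dvd (x + y) ^ (p ^ n) - (x ^ (p ^ n) + y ^ (p ^ n))"
proof (induction n)
  case (Suc n)
  \<comment> \<open>Raise the induction hypothesis to the power \<open>p\<close>, then expand the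
    right-hand sum once more; in the total the middle terms cancel.\<close>
  have "of_nat p dvd ((x + y) ^ (p ^ n)) ^ p - (x ^ (p ^ n) + y ^ (p ^ n)) ^ p"
    using Suc by (rule dvd_power_diff_power)
  moreover have "of_nat p dvd (x ^ (p ^ n) + y ^ (p ^ n)) ^ p - (x ^ (p ^ n)) ^ p - (y ^ (p ^ n)) ^ p"
    by (rule freshmans_dream_dvd[OF assms])
  ultimately have "of_nat p dvd ((x + y) ^ (p ^ n)) ^ p - (x ^ (p ^ n) + y ^ (p ^ n)) ^ p
     + ((x ^ (p ^ n) + y ^ (p ^ n)) ^ p - (x ^ (p ^ n)) ^ p - (y ^ (p ^ n)) ^ p)"
    by (rule dvd_add)
  then show ?case by (simp add: power_mult[symmetric] mult.commute algebra_simps)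
qed simp

text \<open>Fermat's little theorem, iterated: Frobenius with second summand 1 carries the claim
  between neighbouring integers, upwards and downwards from 0.\<close>

lemma prime_dvd_power_prime_power_diff:
  assumes "prime (p::nat)"
  shows "int p dvd a ^ (p ^ n) - a"
proof (induction a rule: int_induct[where k = 0])
  case base
  then show ?case using assms by (simp add: power_0_left prime_gt_0_nat)
next
  case (step1 i)
  have "int p dvd ((i + 1) ^ (p ^ n) - (i ^ (p ^ n) + 1 ^ (p ^ n))) + (i ^ (p ^ n) - i)"
    using freshmans_dream_prime_power_dvd[OF assms, of i 1 n] step1 by (intro dvd_add) auto
  then show ?case by (simp add: algebra_simps)
next
  case (step2 i)
  have "int p dvd (i ^ (p ^ n) - i) - (((i - 1) + 1) ^ (p ^ n) - ((i - 1) ^ (p ^ n) + 1 ^ (p ^ n)))"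
    using freshmans_dream_prime_power_dvd[OF assms, of "i - 1" 1 n] step2
    by (intro dvd_diff[of _ "i ^ (p ^ n) - i"]) simp_all
  then show ?case by (simp add: algebra_simps)
qed

text \<open>Horner induction: \<open>pCons a G\<close> is \<open>a + x * G\<close>, Frobenius splits
  the sum, and Fermat's theorem restores the constant \<open>a\<close>. Composing with the monomial
  substitutes \<open>x ^ (p ^ n)\<close> for \<open>x\<close>.\<close>

lemma frobenius_int_poly:
  fixes F :: "int poly"
  assumes "prime p" 
  shows "of_nat p dvd F ^ (p ^ n) - F \<circ>\<^sub>p monom 1 (p ^ n)"
proof (induction F)
  case 0
  then show ?case using assms by (simp add: power_0_left prime_gt_0_nat)
next
  case (pCons a G)
  let ?q = "p ^ n"
  let ?X = "monom 1 1 :: int poly"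
  have X: "?X ^ ?q = monom 1 ?q" by (simp add: monom_power)
  have eq: "pCons a G = [:a:] + ?X * G"
    by (simp add: monom_altdef)
  have "of_nat p dvd (pCons a G) ^ ?q - ([:a:] ^ ?q + (?X * G) ^ ?q)"
    unfolding eq by (rule freshmans_dream_prime_power_dvd[OF assms])
  moreover have "of_nat p dvd [:a:] ^ ?q - [:a:]"
  proof -
    obtain k where "a ^ ?q - a = int p * k"
      using prime_dvd_power_prime_power_diff[OF assms, of a n] by (elim dvdE)
    then have "[:a:] ^ ?q - [:a:] = of_nat p * [:k:]"
      by (simp add: poly_const_pow of_nat_poly)
    then show ?thesis by (rule dvdI)
  qed
  moreover have "of_nat p dvd ?X ^ ?q * (G ^ ?q - G \<circ>\<^sub>p monom 1 ?q)"
    using pCons.IH by (rule dvd_mult)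
  ultimately have "of_nat p dvd ((pCons a G) ^ ?q - ([:a:] ^ ?q + (?X * G) ^ ?q))
      + ([:a:] ^ ?q - [:a:]) + ?X ^ ?q * (G ^ ?q - G \<circ>\<^sub>p monom 1 ?q)"
    by (intro dvd_add)
  also have "\<dots> = (pCons a G) ^ ?q - ([:a:] + ?X ^ ?q * (G \<circ>\<^sub>p monom 1 ?q))"
    by (simp add: power_mult_distrib right_diff_distrib)
  finally show ?case by (simp only: pcompose_pCons X)
qed

lemma of_nat_dvd_int_poly_iff:
  "of_nat p dvd (P :: int poly) \<longleftrightarrow> (\<forall>i. int p dvd coeff P i)"
  using const_poly_dvd_iff[of "int p" P] by (simp add: of_nat_poly)

subsection \<open>Counting coefficients modulo a prime\<close>

text \<open>The number of terms of the reduction of \<open>P\<close> modulo \<open>p\<close>;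
  integer representatives avoid a coefficient type depending on \<open>p\<close>.\<close>

definition weight_mod :: "nat \<Rightarrow> int poly \<Rightarrow> nat" where
  "weight_mod p P = card {i. \<not> int p dvd coeff P i}"

lemma finite_coeff_not_dvd: "finite {i. \<not> int p dvd coeff P i}"
  by (rule finite_subset[of _ "{..degree P}"]) (auto intro!: leI simp: coeff_eq_0)

lemma weight_mod_cong:
  assumes "of_nat p dvd P - Q"
  shows "weight_mod p P = weight_mod p Q"
proof -
  have "int p dvd coeff P i \<longleftrightarrow> int p dvd coeff Q i" for i
    using assms[unfolded of_nat_dvd_int_poly_iff, rule_format, of i]
    by (auto dest: dvd_diffD dvd_diffD1 simp: dvd_diff_commute intro: dvd_diff_left_iff[THEN iffD1])
  then show ?thesis by (simp add: weight_mod_def)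
qed

section \<open>Splitting a polynomial by its exponents modulo \<open>q\<close>\<close>

text \<open>For \<open>q > 0\<close>, \<open>G\<close> is the sum over \<open>t < q\<close> of
  \<open>x ^ t\<close> times its section evaluated at \<open>x ^ q\<close>. The summation bound is
  merely safe, since \<open>k \<le> q * k\<close>.\<close>

definition poly_section :: "nat \<Rightarrow> nat \<Rightarrow> 'a::comm_ring_1 poly \<Rightarrow> 'a poly" where
  "poly_section q t G = (\<Sum>k\<le>degree G. monom (coeff G (t + q * k)) k)"

lemma coeff_poly_section:
  assumes "q > 0"
  shows "coeff (poly_section q t G) k = coeff G (t + q * k)"
proof -
  have "coeff G (t + q * k) = 0" if "k > degree G"
  proof -
    have "k \<le> q * k" using assms by simp
    then show ?thesis using that by (intro coeff_eq_0) linarith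
  qed
  then show ?thesis by (auto simp: poly_section_def coeff_sum)
qed

lemma degree_poly_section_le:
  assumes "q > 0" "degree G < q * Suc n"
  shows "degree (poly_section q t G) \<le> n"
proof (rule degree_le, intro allI impI)
  fix i assume "n < i"
  then have "q * Suc n \<le> q * i" by (intro mult_le_mono) auto
  then show "coeff (poly_section q t G) i = 0"
    using assms by (simp add: coeff_poly_section coeff_eq_0)
qed

text \<open>A factor in \<open>x ^ q\<close> moves exponents by multiples of \<open>q\<close>, so
  residue classes do not mix and each section is multiplied by \<open>H\<close> separately.\<close>

lemma coeff_mult_pcompose_monom:
  assumes "t < q"
  shows "coeff (G * (H \<circ>\<^sub>p monom 1 q)) (t + q * k) = coeff (poly_section q t G * H) k"
proof (induction H arbitrary: k)
  case (pCons a H)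
  have "G * (pCons a H \<circ>\<^sub>p monom 1 q) = smult a G + monom 1 q * (G * (H \<circ>\<^sub>p monom 1 q))"
    by (simp add: pcompose_pCons algebra_simps)
  \<comment> \<open>Multiplication by \<open>monom 1 q\<close> shifts \<open>k\<close> by 1; only
    for \<open>k = 0\<close> does the shifted term contribute nothing, because
    \<open>t < q\<close>.\<close>
  moreover have "t + q * k - q = t + q * (k - 1)" if "k > 0"
    using that by (cases k) auto
  moreover have "t + q * k < q \<longleftrightarrow> k = 0"
    using assms by (cases k) auto
  ultimately show ?case
    using assms pCons.IH[of "k - 1"]
    by (cases k) (auto simp: coeff_monom_mult coeff_poly_section coeff_pCons)
qed simp

lemma pcompose_power: "(P ^ n) \<circ>\<^sub>p Q = (P \<circ>\<^sub>p Q) ^ n" for P :: "'a::comm_ring_1 poly"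
  by (induction n) (simp_all add: pcompose_1 pcompose_mult)

text \<open>Different residues occupy disjoint sets of exponents. A subset \<open>T\<close> of the
  residues is allowed because one or two classes suffice later.\<close>

lemma sum_weight_mod_sections_le:
  assumes "finite T" "T \<subseteq> {..<q}"
  shows "(\<Sum>t\<in>T. weight_mod p (poly_section q t G * H)) \<le> weight_mod p (G * (H \<circ>\<^sub>p monom 1 q))"
proof -
  let ?A = "\<lambda>t. {k. \<not> int p dvd coeff (poly_section q t G * H) k}"
  let ?P = "G * (H \<circ>\<^sub>p monom 1 q)"
  have "(\<Sum>t\<in>T. weight_mod p (poly_section q t G * H)) = card (SIGMA t:T. ?A t)"
    using assms(1) by (simp add: weight_mod_def card_SigmaI finite_coeff_not_dvd)
  also have "\<dots> \<le> card {i. \<not> int p dvd coeff ?P i}"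
  proof (rule card_inj_on_le[where f = "\<lambda>(t, k). t + q * k"])
    show "inj_on (\<lambda>(t, k). t + q * k) (SIGMA t:T. ?A t)"
    proof (rule inj_onI, clarify)
      fix t k t' k' assume T: "t \<in> T" "t' \<in> T" and eq: "t + q * k = t' + q * k'"
      then have "t < q" "t' < q" using assms(2) by auto
      with arg_cong[OF eq, of "\<lambda>x. x mod q"] arg_cong[OF eq, of "\<lambda>x. x div q"]
      show "t = t' \<and> k = k'" by simp
    qed
    show "(\<lambda>(t, k). t + q * k) ` (SIGMA t:T. ?A t) \<subseteq> {i. \<not> int p dvd coeff ?P i}"
      using assms(2) by (auto simp: coeff_mult_pcompose_monom subset_eq)
  qed (rule finite_coeff_not_dvd)
  finally show ?thesis by (simp add: weight_mod_def)
qed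

section \<open>Lowest and highest terms of products modulo \<open>p\<close>\<close>

text \<open>All other contributions to this coefficient vanish modulo \<open>p\<close>, and a
  product of two nonzero residues is nonzero for prime \<open>p\<close>.\<close>

lemma not_dvd_coeff_mult:
  assumes "prime p" and "\<not> int p dvd coeff C i0" "\<not> int p dvd coeff F j0"
    and other: "\<And>i. i \<le> i0 + j0 \<Longrightarrow> i \<noteq> i0 \<Longrightarrow>
        int p dvd coeff C i \<or> int p dvd coeff F (i0 + j0 - i)"
  shows "\<not> int p dvd coeff (C * F) (i0 + j0)"
proof -
  have "coeff (C * F) (i0 + j0) = (\<Sum>i\<le>i0 + j0. coeff C i * coeff F (i0 + j0 - i))"
    by (rule coeff_mult)
  also have "\<dots> = coeff C i0 * coeff F j0
      + (\<Sum>i\<in>{..i0 + j0} - {i0}. coeff C i * coeff F (i0 + j0 - i))"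
    by (subst sum.remove[of _ i0]) auto
  finally have eq: "coeff (C * F) (i0 + j0) = \<dots>" .
  have "int p dvd (\<Sum>i\<in>{..i0 + j0} - {i0}. coeff C i * coeff F (i0 + j0 - i))"
    using other by (intro dvd_sum) (metis DiffE atMost_iff dvd_mult dvd_mult2 singletonI)
  moreover have "\<not> int p dvd coeff C i0 * coeff F j0"
    using assms(1-3) by (simp add: prime_dvd_mult_iff)
  ultimately show ?thesis unfolding eq by (simp add: dvd_add_left_iff)
qed

text \<open>The extreme exponent of a product splits in only one way: any other splitting takes one
  factor beyond its own extreme.\<close>

lemma not_dvd_coeff_mult_extremes:
  assumes p: "prime p" and C: "\<exists>i. \<not> int p dvd coeff C i"
    and F: "\<exists>i. \<not> int p dvd coeff F i"
  defines "A \<equiv> {i. \<not> int p dvd coeff C i}" and "B \<equiv> {i. \<not> int p dvd coeff F i}"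
  shows "\<not> int p dvd coeff (C * F) (Max A + Max B)"
    and "\<not> int p dvd coeff (C * F) (Min A + Min B)"
proof -
  have A: "finite A" "A \<noteq> {}" and B: "finite B" "B \<noteq> {}"
    using C F by (auto simp: A_def B_def finite_coeff_not_dvd)
  have mem: "Max A \<in> A" "Min A \<in> A" "Max B \<in> B" "Min B \<in> B"
    using A B by auto
  show "\<not> int p dvd coeff (C * F) (Max A + Max B)"
  proof (rule not_dvd_coeff_mult[OF p])
    fix i assume "i \<le> Max A + Max B" "i \<noteq> Max A"
    then have "i > Max A \<or> Max A + Max B - i > Max B" by auto
    then have "i \<notin> A \<or> Max A + Max B - i \<notin> B"
      using A B Max_ge not_le by blast
    then show "int p dvd coeff C i \<or> int p dvd coeff F (Max A + Max B - i)"
      by (auto simp: A_def B_def)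
  qed (use mem in \<open>auto simp: A_def B_def\<close>)
  show "\<not> int p dvd coeff (C * F) (Min A + Min B)"
  proof (rule not_dvd_coeff_mult[OF p])
    fix i assume "i \<le> Min A + Min B" "i \<noteq> Min A"
    then have "i < Min A \<or> Min A + Min B - i < Min B" by auto
    then have "i \<notin> A \<or> Min A + Min B - i \<notin> B"
      using A B Min_le not_le by blast
    then show "int p dvd coeff C i \<or> int p dvd coeff F (Min A + Min B - i)"
      by (auto simp: A_def B_def)
  qed (use mem in \<open>auto simp: A_def B_def\<close>)
qed

lemma ex_coeff_not_dvd_mult_power:
  assumes "prime p" "\<exists>i. \<not> int p dvd coeff C i" "\<exists>i. \<not> int p dvd coeff F i"
  shows "\<exists>i. \<not> int p dvd coeff (C * F ^ r) i"
proof (induction r)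
  case (Suc r)
  then have "\<exists>i. \<not> int p dvd coeff ((C * F ^ r) * F) i"
    using not_dvd_coeff_mult_extremes(1)[OF assms(1) _ assms(3)] by blast
  then show ?case by (simp add: mult_ac)
qed (use assms in simp)

text \<open>Two terms of \<open>F\<close> separate its lowest and highest exponents, hence also
  those of the product.\<close>

lemma two_coeffs_not_dvd_mult:
  assumes p: "prime p" and C: "\<exists>i. \<not> int p dvd coeff C i"
    and F: "weight_mod p F \<ge> 2"
  obtains i j where "i \<noteq> j" "\<not> int p dvd coeff (C * F) i" "\<not> int p dvd coeff (C * F) j"
proof -
  let ?A = "{i. \<not> int p dvd coeff C i}" and ?B = "{i. \<not> int p dvd coeff F i}"
  have A: "finite ?A" "?A \<noteq> {}"
    using C by (auto simp: finite_coeff_not_dvd)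
  have "card ?B \<noteq> 0" using F by (simp add: weight_mod_def)
  then have B: "finite ?B" "?B \<noteq> {}" by (auto simp: card_eq_0_iff)
  have "Min ?B < Max ?B"
  proof (rule ccontr)
    assume "\<not> Min ?B < Max ?B"
    moreover have "Min ?B \<le> i" "i \<le> Max ?B" if "i \<in> ?B" for i
      using B(1) that by (rule Min_le, rule Max_ge)
    ultimately have "i = Max ?B" if "i \<in> ?B" for i
      using that by (meson antisym leI order_trans)
    then have "?B \<subseteq> {Max ?B}" by blast
    then have "card ?B \<le> 1" using card_mono[of "{Max ?B}" ?B] by simp
    with F show False by (simp add: weight_mod_def)
  qed
  moreover have "Min ?A \<le> Max ?A" using A by (meson Max_ge Min_in)
  ultimately have "Min ?A + Min ?B \<noteq> Max ?A + Max ?B" by linarith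
  moreover have F1: "\<exists>i. \<not> int p dvd coeff F i" using B by blast
  ultimately show thesis
    using that not_dvd_coeff_mult_extremes[OF p C F1] by simp
qed

section \<open>Digits 1 of the exponent and the doubling of terms\<close>

text \<open>The value 0 for \<open>q < 2\<close> is a convention that makes the recursion
  terminate.\<close>

function ones_digits :: "nat \<Rightarrow> nat \<Rightarrow> nat" where
  "ones_digits q j = (if q < 2 \<or> j = 0 then 0
     else ones_digits q (j div q) + (if j mod q = 1 then 1 else 0))"
  by auto
termination by (relation "Wellfounded.measure snd") auto

declare ones_digits.simps [simp del]

lemma ones_digits_0 [simp]: "ones_digits q 0 = 0"
  by (simp add: ones_digits.simps)

lemma ones_digits_step:
  "q \<ge> 2 \<Longrightarrow> ones_digits q j = ones_digits q (j div q) + (if j mod q = 1 then 1 else 0)"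
  by (cases "j = 0") (simp_all add: ones_digits.simps[of q j])

text \<open>The coefficients of \<open>C * F ^ j\<close> are sorted by their index modulo \<open>q\<close>: for \<open>j = q * m + r\<close>,
  the class of \<open>t\<close> is \<open>C\<^sub>t * F ^ m\<close> modulo \<open>p\<close>, where \<open>C\<^sub>t\<close> is the \<open>t\<close>-th section of
  \<open>C * F ^ r\<close>. The degree bound \<open>e\<close> is inherited by \<open>C\<^sub>t\<close>, and for \<open>r = 1\<close> the sections are
  constants of which at least two survive.\<close>

lemma weight_mod_mult_power_ge:
  assumes p: "prime p" and q: "q = p ^ L" and F2: "weight_mod p F \<ge> 2"
    and deg: "degree F \<le> e" "2 * e < q" "q \<ge> 2"
    and C: "\<exists>i. \<not> int p dvd coeff C i" "degree C \<le> e"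
  shows "2 ^ ones_digits q j \<le> weight_mod p (C * F ^ j)"
  using C
proof (induction j arbitrary: C rule: less_induct)
  case (less j)
  show ?case
  proof (cases "j = 0")
    case True
    obtain i where "i \<in> {i. \<not> int p dvd coeff C i}" using less.prems by blast
    then have "card {i. \<not> int p dvd coeff C i} > 0"
      by (metis card_gt_0_iff empty_iff finite_coeff_not_dvd)
    then show ?thesis using True by (simp add: weight_mod_def)
  next
    case False
    define m r where "m = j div q" and "r = j mod q"
    define G where "G = C * F ^ r"
    have j: "j = q * m + r" and r: "r < q" using deg by (simp_all add: m_def r_def)
    have mj: "m < j" using False deg by (simp add: m_def)
    have "card {i. \<not> int p dvd coeff F i} \<noteq> 0" using F2 by (simp add: weight_mod_def)
    then have F1: "\<exists>i. \<not> int p dvd coeff F i" by (auto simp: card_eq_0_iff)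
    \<comment> \<open>Modulo \<open>p\<close>, \<open>F ^ (q * m)\<close> is \<open>F ^ m\<close> in
      the variable \<open>x ^ q\<close>; what remains to be split into sections is
      \<open>G\<close>.\<close>
    have "of_nat p dvd (F ^ q) ^ m - (F \<circ>\<^sub>p monom 1 q) ^ m"
      unfolding q by (intro dvd_power_diff_power frobenius_int_poly p)
    then have "of_nat p dvd G * ((F ^ q) ^ m - (F \<circ>\<^sub>p monom 1 q) ^ m)"
      by (rule dvd_mult)
    also have "G * ((F ^ q) ^ m - (F \<circ>\<^sub>p monom 1 q) ^ m)
        = C * F ^ j - G * ((F ^ m) \<circ>\<^sub>p monom 1 q)"
      by (simp add: G_def j power_add power_mult[symmetric] pcompose_power algebra_simps)
    finally have w: "weight_mod p (C * F ^ j) = weight_mod p (G * ((F ^ m) \<circ>\<^sub>p monom 1 q))"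
      by (rule weight_mod_cong)
    have degG: "degree G \<le> e + e * r"
    proof -
      have "degree G \<le> degree C + degree (F ^ r)" unfolding G_def by (rule degree_mult_le)
      also have "degree (F ^ r) \<le> degree F * r" by (rule degree_power_le)
      also have "degree F * r \<le> e * r" using deg by simp
      finally show ?thesis using less.prems by linarith
    qed
    \<comment> \<open>Taking sections divides the degree by \<open>q\<close>, which offsets the
      growth by the factor \<open>r + 1 \<le> q\<close>; thus the bound \<open>e\<close> reproduces
      itself.\<close>
    have "e + e * r \<le> e * q"
      using mult_le_mono2[of "Suc r" q e] r by simp
    also have "\<dots> < q * Suc e" using deg by (simp add: mult.commute)
    finally have degs: "degree (poly_section q t G) \<le> e" for t
      using degG deg by (intro degree_poly_section_le) auto
    have sec: "2 ^ ones_digits q m \<le> weight_mod p (poly_section q (i mod q) G * F ^ m)"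
      if "\<not> int p dvd coeff G i" for i
    proof (rule less.IH[OF mj _ degs])
      have "coeff (poly_section q (i mod q) G) (i div q) = coeff G i"
        using deg by (simp add: coeff_poly_section)
      then show "\<exists>k. \<not> int p dvd coeff (poly_section q (i mod q) G) k" using that by metis
    qed
    show ?thesis
    proof (cases "r = 1")
      case False
      obtain i where i: "\<not> int p dvd coeff G i"
        using ex_coeff_not_dvd_mult_power[OF p less.prems(1) F1] unfolding G_def by blast
      have "(2::nat) ^ ones_digits q j = 2 ^ ones_digits q m"
        using False deg by (simp add: ones_digits_step[of q j] m_def r_def)
      also have "\<dots> \<le> (\<Sum>t\<in>{i mod q}. weight_mod p (poly_section q t G * F ^ m))"
        using sec[OF i] by simp
      also have "\<dots> \<le> weight_mod p (C * F ^ j)"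
        unfolding w using deg by (intro sum_weight_mod_sections_le) auto
      finally show ?thesis .
    next
      case True
      obtain i k where ik: "i \<noteq> k" "\<not> int p dvd coeff G i" "\<not> int p dvd coeff G k"
        using two_coeffs_not_dvd_mult[OF p less.prems(1) F2] unfolding G_def True by auto
      \<comment> \<open>Here \<open>G\<close> has degree at most \<open>2 * e < q\<close>, so its
        exponents are their own residues and \<open>i\<close>, \<open>k\<close> lie in different
        classes.\<close>
      have "l < q" if "\<not> int p dvd coeff G l" for l
      proof -
        have "l \<le> degree G" using that by (auto intro!: leI simp: coeff_eq_0)
        then show ?thesis using degG deg True by simp
      qed
      then have lt: "i < q" "k < q" using ik by auto
      have "(2::nat) ^ ones_digits q j = 2 ^ ones_digits q m + 2 ^ ones_digits q m"
        using True deg by (simp add: ones_digits_step[of q j] m_def r_def)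
      also have "\<dots> \<le> (\<Sum>t\<in>{i, k}. weight_mod p (poly_section q t G * F ^ m))"
        using sec[OF ik(2)] sec[OF ik(3)] ik(1) lt by simp
      also have "\<dots> \<le> weight_mod p (C * F ^ j)"
        unfolding w using lt by (intro sum_weight_mod_sections_le) auto
      finally show ?thesis .
    qed
  qed
qed

subsection \<open>Density\<close>

text \<open>Splitting off the last digit contributes the factor \<open>q - 1/2\<close>: weight 1/2
  for the digit 1 and weight 1 for each of the \<open>q - 1\<close> others.\<close>

lemma sum_half_power_ones_digits:
  assumes "q \<ge> 2"
  shows "(\<Sum>j<q ^ n. (1/2) ^ ones_digits q j) = (real q - 1/2) ^ n"
proof (induction n)
  case (Suc n)
  let ?h = "\<lambda>j. (1/2 :: real) ^ ones_digits q j"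
  have digit: "(\<Sum>r<q. if r = 1 then 1/2 else 1 :: real) = real q - 1/2"
    using assms by (subst sum.remove[of _ 1]) (auto simp: sum.If_cases of_nat_diff)
  have "(\<Sum>j<q * q ^ n. ?h j) = (\<Sum>(m, r)\<in>{..<q ^ n} \<times> {..<q}. ?h (q * m + r))"
  proof (rule sum.reindex_bij_witness[where j = "\<lambda>j. (j div q, j mod q)" and i = "\<lambda>(m, r). q * m + r"])
    fix a assume "a \<in> {..<q ^ n} \<times> {..<q}"
    then obtain m r where a: "a = (m, r)" "m < q ^ n" "r < q" by auto
    have "q * m + r < q * Suc m" using a by simp
    also have "\<dots> \<le> q * q ^ n" using a by (intro mult_le_mono2) simp
    finally show "(case a of (m, r) \<Rightarrow> q * m + r) \<in> {..<q * q ^ n}" using a by simp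
  qed (use assms in \<open>auto simp: less_mult_imp_div_less mult.commute\<close>)
  also have "\<dots> = (\<Sum>(m, r)\<in>{..<q ^ n} \<times> {..<q}. ?h m * (if r = 1 then 1/2 else 1))"
    using assms by (intro sum.cong) (auto simp: ones_digits_step[of q "q * _ + _"])
  also have "\<dots> = (\<Sum>m<q ^ n. ?h m) * (real q - 1/2)"
    by (simp only: digit[symmetric] sum_product sum.cartesian_product)
  finally show ?case using Suc by simp
qed simp

text \<open>Markov's inequality: the weight \<open>2 ^ M * (1/2) ^ ones_digits q j\<close> is at
  least 1 on the exceptional set, while its sum up to \<open>q ^ n\<close> is exponentially smaller
  than \<open>q ^ n\<close>.\<close>

lemma ones_digits_less_density_zero:
  assumes "q \<ge> 2"
  shows "(\<lambda>N. real (card {j\<in>{1..N}. ones_digits q j < M}) / real N) \<longlonglongrightarrow> 0"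
proof (rule LIMSEQ_I)
  fix \<epsilon> :: real assume "\<epsilon> > 0"
  \<comment> \<open>The average weight of a single digit.\<close>
  define \<theta> where "\<theta> = (real q - 1/2) / real q"
  have \<theta>: "0 < \<theta>" "\<theta> < 1" using assms by (auto simp: \<theta>_def field_simps)
  have "(\<lambda>n. 2 ^ M * real q * \<theta> ^ n) \<longlonglongrightarrow> 2 ^ M * real q * 0"
    using \<theta> by (intro tendsto_mult_left LIMSEQ_power_zero) auto
  then have "\<forall>\<^sub>F n in sequentially. 2 ^ M * real q * \<theta> ^ n < \<epsilon>"
    using \<open>\<epsilon> > 0\<close> by (intro order_tendstoD(2)) auto
  then obtain n0 where n0: "\<And>n. n \<ge> n0 \<Longrightarrow> 2 ^ M * real q * \<theta> ^ n < \<epsilon>"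
    by (auto simp: eventually_sequentially)
  have "real (card {j\<in>{1..N}. ones_digits q j < M}) / real N < \<epsilon>" if N: "N \<ge> q ^ n0" for N
  proof -
    have "q ^ n0 \<ge> 1" using assms by (intro one_le_power) auto
    then have N1: "N \<ge> 1" using N by linarith
    \<comment> \<open>The sum is known up to powers of \<open>q\<close>, so \<open>N\<close> is
      rounded up to the next one; the constant factor \<open>q\<close> in the bound pays for
      this.\<close>
    obtain n where n: "q ^ n \<le> N" "N < q ^ (n + 1)"
      using ex_power_ivl1[OF assms N1] by blast
    have "q ^ n0 < q ^ (n + 1)" using N n by linarith
    then have "n \<ge> n0" using assms power_less_imp_less_exp[of q n0 "n + 1"] by simp
    let ?S = "{j\<in>{1..N}. ones_digits q j < M}"
    have "real (card ?S) = (\<Sum>j\<in>?S. 1)" by simp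
    also have "\<dots> \<le> (\<Sum>j\<in>?S. 2 ^ M * (1/2) ^ ones_digits q j)"
    proof (rule sum_mono)
      fix j assume "j \<in> ?S"
      then have "(2::real) ^ ones_digits q j \<le> 2 ^ M" by (intro power_increasing) auto
      then show "(1::real) \<le> 2 ^ M * (1/2) ^ ones_digits q j"
        by (simp add: power_one_over field_simps)
    qed
    also have "\<dots> \<le> (\<Sum>j<q ^ Suc n. 2 ^ M * (1/2) ^ ones_digits q j)"
      using n by (intro sum_mono2) auto
    also have "\<dots> = 2 ^ M * (real q - 1/2) ^ Suc n"
      by (simp only: sum_distrib_left[symmetric] sum_half_power_ones_digits[OF assms])
    also have "\<dots> \<le> 2 ^ M * real q * (real q - 1/2) ^ n"
      using assms by (simp add: mult_right_mono)
    also have "\<dots> = 2 ^ M * real q * \<theta> ^ n * real q ^ n"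
      using assms by (simp add: \<theta>_def power_divide)
    also have "\<dots> \<le> 2 ^ M * real q * \<theta> ^ n * real N"
      using n \<theta> by (intro mult_left_mono) (auto simp flip: of_nat_power)
    also have "\<dots> < \<epsilon> * real N"
      using n0[OF \<open>n \<ge> n0\<close>] N1 by (intro mult_strict_right_mono) auto
    finally show ?thesis using N1 by (simp add: field_simps)
  qed
  then show "\<exists>no. \<forall>N\<ge>no. norm (real (card {j\<in>{1..N}. ones_digits q j < M}) / real N - 0) < \<epsilon>"
    by auto
qed

text \<open>A diagonal argument: the demands \<open>M \<le> w j\<close> are imposed one after
  another, each only once its exceptional set has become sparse.\<close>

lemma density_one_set_tendsto_infinity:
  fixes w :: "nat \<Rightarrow> nat"
  assumes dens: "\<And>M. (\<lambda>N. real (card {j\<in>{1..N}. w j < M}) / real N) \<longlonglongrightarrow> 0"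
  obtains J where "(\<lambda>N. real (card (J \<inter> {1..N})) / real N) \<longlonglongrightarrow> 1"
    and "\<And>M. \<exists>j0. \<forall>j\<in>J. j \<ge> j0 \<longrightarrow> w j \<ge> M"
proof -
  let ?B = "\<lambda>M N. real (card {j\<in>{1..N}. w j < M}) / real N"
  have "\<exists>T. \<forall>N\<ge>T. ?B M N < 1 / Suc M" for M
    using order_tendstoD(2)[OF dens[of M], of "1 / Suc M"] by (auto simp: eventually_sequentially)
  then obtain T where T: "\<And>M N. N \<ge> T M \<Longrightarrow> ?B M N < 1 / Suc M" by metis
  \<comment> \<open>Demand \<open>M\<close> takes effect from \<open>max M (T M)\<close> on;
    bounding \<open>M\<close> by \<open>j\<close> leaves finitely many demands at each
    \<open>j\<close>.\<close>
  define J where "J = {j. \<forall>M\<le>j. T M \<le> j \<longrightarrow> M \<le> w j}"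
  have w: "w j \<ge> M" if "j \<in> J" "j \<ge> max M (T M)" for j M
    using that by (auto simp: J_def)
  have lim: "(\<lambda>N. real (card ({1..N} - J)) / real N) \<longlonglongrightarrow> 0"
  proof (rule LIMSEQ_I)
    fix \<epsilon> :: real assume "\<epsilon> > 0"
    obtain M0 where M0: "1 / Suc M0 < \<epsilon>" using nat_approx_posE[OF \<open>\<epsilon> > 0\<close>] by blast
    have "real (card ({1..N} - J)) / real N < \<epsilon>" if N: "N \<ge> max M0 (T M0)" for N
    proof -
      \<comment> \<open>The strongest demand in effect by \<open>N\<close>. Every omitted
        \<open>j \<le> N\<close> fails some demand up to \<open>K\<close>, hence has
        \<open>w j < K\<close>.\<close>
      define K where "K = Max {M. M \<le> N \<and> T M \<le> N}"
      have fin: "finite {M. M \<le> N \<and> T M \<le> N}" by simp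
      have "M0 \<in> {M. M \<le> N \<and> T M \<le> N}" using N by simp
      then have K: "T K \<le> N" and KM: "K \<ge> M0"
        using Max_in[OF fin] Max_ge[OF fin] by (auto simp: K_def)
      have "{1..N} - J \<subseteq> {j\<in>{1..N}. w j < K}"
      proof
        fix j assume "j \<in> {1..N} - J"
        then obtain M where M: "j \<in> {1..N}" "M \<le> j" "T M \<le> j" "w j < M"
          by (auto simp: J_def not_le)
        then have "M \<le> K" unfolding K_def by (intro Max_ge[OF fin]) auto
        with M show "j \<in> {j\<in>{1..N}. w j < K}" by auto
      qed
      then have "card ({1..N} - J) \<le> card {j\<in>{1..N}. w j < K}" by (intro card_mono) auto
      then have "real (card ({1..N} - J)) / real N \<le> ?B K N"
        by (intro divide_right_mono) auto
      also have "\<dots> < 1 / Suc K" using K by (intro T)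
      also have "\<dots> \<le> 1 / Suc M0" using KM by (simp add: frac_le)
      finally show ?thesis using M0 by linarith
    qed
    then show "\<exists>no. \<forall>N\<ge>no. norm (real (card ({1..N} - J)) / real N - 0) < \<epsilon>"
      by (intro exI[of _ "max M0 (T M0)"]) auto
  qed
  have "(\<lambda>N. 1 - real (card ({1..N} - J)) / real N) \<longlonglongrightarrow> 1 - 0"
    by (intro tendsto_diff tendsto_const lim)
  moreover have "\<forall>\<^sub>F N in sequentially.
      1 - real (card ({1..N} - J)) / real N = real (card (J \<inter> {1..N})) / real N"
  \<comment> \<open>At \<open>N = 0\<close> the two sides differ, since division by 0 gives
    0.\<close>
  proof (rule eventually_sequentiallyI[of 1])
    fix N :: nat assume "N \<ge> 1"
    have "card {1..N} = card (J \<inter> {1..N}) + card ({1..N} - J)"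
      using card_Int_Diff[of "{1..N}" J] by (simp add: Int_commute)
    then have "real N = real (card (J \<inter> {1..N})) + real (card ({1..N} - J))" by simp
    then show "1 - real (card ({1..N} - J)) / real N = real (card (J \<inter> {1..N})) / real N"
      using \<open>N \<ge> 1\<close> by (simp add: field_simps)
  qed
  ultimately have "(\<lambda>N. real (card (J \<inter> {1..N})) / real N) \<longlonglongrightarrow> 1"
    by (simp add: tendsto_cong)
  then show thesis using w that by blast
qed

subsection \<open>Characters\<close>

text \<open>Convolution with \<open>f\<close> on \<open>U\<close>, the product of Laurent
  polynomials. It is not reduced modulo \<open>p\<close>, so iterates correspond to exact products
  over the integers.\<close>

definition lca_dual :: "(int^'d) set \<Rightarrow> ((int^'d) \<Rightarrow> int) \<Rightarrow> ((int^'d) \<Rightarrow> int) \<Rightarrow> ((int^'d) \<Rightarrow> int)" where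
  "lca_dual U f g m = (\<Sum>u\<in>U. f u * g (m - u))"

lemma lca_dual_support_subset:
  "{m. lca_dual U f g m \<noteq> 0} \<subseteq> (\<lambda>(u, n). u + n) ` (U \<times> {n. g n \<noteq> 0})"
proof
  fix m assume "m \<in> {m. lca_dual U f g m \<noteq> 0}"
  then obtain u where "u \<in> U" "f u * g (m - u) \<noteq> 0"
    unfolding lca_dual_def using sum.not_neutral_contains_not_neutral by blast
  then show "m \<in> (\<lambda>(u, n). u + n) ` (U \<times> {n. g n \<noteq> 0})"
    by (intro image_eqI[where x = "(u, m - u)"]) auto
qed

lemma finite_support_lca_dual:
  assumes "finite U" "finite {n. g n \<noteq> 0}"
  shows "finite {m. lca_dual U f g m \<noteq> 0}"
  using assms by (intro finite_subset[OF lca_dual_support_subset]) auto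

lemma finite_support_lca_dual_funpow:
  assumes "finite U" "finite {n. c n \<noteq> 0}"
  shows "finite {m. (lca_dual U f ^^ j) c m \<noteq> 0}"
  using assms by (induction j) (auto intro: finite_support_lca_dual)

text \<open>Reindexing by \<open>m = u + n\<close>. The additive \<open>h\<close> is left abstract
  to serve both the phase of a character and the monomials of a projected polynomial.\<close>

lemma sum_lca_dual:
  fixes h :: "int \<Rightarrow> (int^'d) \<Rightarrow> 'a::comm_monoid_add"
  assumes fin: "finite U" "finite {n. g n \<noteq> 0}"
    and h: "\<And>m. h 0 m = 0" "\<And>x y m. h (x + y) m = h x m + h y m"
  shows "(\<Sum>m | lca_dual U f g m \<noteq> 0. h (lca_dual U f g m) m)
    = (\<Sum>u\<in>U. \<Sum>n | g n \<noteq> 0. h (f u * g n) (u + n))"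
proof -
  let ?S = "(\<lambda>(u, n). u + n) ` (U \<times> {n. g n \<noteq> 0})"
  have S: "finite ?S" using fin by auto
  have hsum: "h (\<Sum>u\<in>V. k u) m = (\<Sum>u\<in>V. h (k u) m)" if "finite V" for V and k :: "int^'d \<Rightarrow> int" and m
    using that by (induction V) (auto simp: h)
  have "(\<Sum>m | lca_dual U f g m \<noteq> 0. h (lca_dual U f g m) m) = (\<Sum>m\<in>?S. h (lca_dual U f g m) m)"
    using lca_dual_support_subset[of U f g] by (intro sum.mono_neutral_left S) (auto simp: h)
  also have "\<dots> = (\<Sum>u\<in>U. \<Sum>m\<in>?S. h (f u * g (m - u)) m)"
    by (simp add: lca_dual_def hsum[OF fin(1)] sum.swap[of _ ?S])
  also have "\<dots> = (\<Sum>u\<in>U. \<Sum>n | g n \<noteq> 0. h (f u * g n) (u + n))"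
  proof (rule sum.cong[OF refl])
    fix u assume u: "u \<in> U"
    have "(\<Sum>m\<in>?S. h (f u * g (m - u)) m) = (\<Sum>m\<in>(+) u ` {n. g n \<noteq> 0}. h (f u * g (m - u)) m)"
    proof (rule sum.mono_neutral_right[OF S])
      show "\<forall>m\<in>?S - (+) u ` {n. g n \<noteq> 0}. h (f u * g (m - u)) m = 0"
      proof
        fix m assume "m \<in> ?S - (+) u ` {n. g n \<noteq> 0}"
        then have "g (m - u) = 0" by (metis (mono_tags, lifting) DiffE add_diff_cancel_left' diff_add_cancel add.commute image_eqI mem_Collect_eq)
        then show "h (f u * g (m - u)) m = 0" by (simp add: h)
      qed
    qed (use u in auto)
    also have "\<dots> = (\<Sum>n | g n \<noteq> 0. h (f u * g n) (u + n))"
      by (subst sum.reindex) auto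
    finally show "(\<Sum>m\<in>?S. h (f u * g (m - u)) m) = (\<Sum>n | g n \<noteq> 0. h (f u * g n) (u + n))" .
  qed
  finally show ?thesis .
qed

lemma prod_cis: "(\<Prod>n\<in>A. cis (t n)) = cis (\<Sum>n\<in>A. t n)"
  by (induction A rule: infinite_finite_induct) (auto simp: cis_mult)

text \<open>A single exponential of a linear form turns equality of character values into a
  congruence modulo \<open>p\<close>.\<close>

lemma chr_eq_cis_sum:
  "chr p g a = cis (2 * pi * real_of_int (\<Sum>n | g n \<noteq> 0. g n * a n) / real_of_int p)"
  unfolding chr_def prod_cis by (simp add: sum_distrib_left sum_divide_distrib)

lemma cis_frac_eq_iff:
  fixes p x y :: int
  assumes "p > 0"
  shows "cis (2 * pi * x / p) = cis (2 * pi * y / p) \<longleftrightarrow> p dvd x - y"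
proof -
  have "cis (2 * pi * x / p) = cis (2 * pi * y / p)
      \<longleftrightarrow> (\<exists>n::int. 2 * pi * x / p = 2 * pi * y / p + 2 * pi * n)"
    using sin_cos_eq_iff[of "2 * pi * x / p" "2 * pi * y / p"]
    by (auto simp: complex_eq_iff)
  also have "\<dots> \<longleftrightarrow> (\<exists>n::int. x = y + p * n)"
  proof (rule ex_cong1)
    fix n :: int
    have "2 * pi * x / p = 2 * pi * y / p + 2 * pi * n \<longleftrightarrow>
        (2 * pi) * real_of_int x = (2 * pi) * real_of_int (y + p * n)"
      using assms by (simp add: field_simps)
    also have "\<dots> \<longleftrightarrow> real_of_int x = real_of_int (y + p * n)"
      by (subst mult_cancel_left) simp
    finally have "2 * pi * x / p = 2 * pi * y / p + 2 * pi * n \<longleftrightarrow> real_of_int x = real_of_int (y + p * n)" .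
    then show "2 * pi * x / p = 2 * pi * y / p + 2 * pi * n \<longleftrightarrow> x = y + p * n"
      by (simp only: of_int_eq_iff)
  qed
  also have "\<dots> \<longleftrightarrow> p dvd x - y" by (auto simp: dvd_def algebra_simps)
  finally show ?thesis .
qed

lemma chr_cong_mod:
  assumes "p > 0" "finite {n. g n \<noteq> 0}"
  shows "chr p (\<lambda>n. g n mod p) a = chr p g a"
proof -
  let ?S = "{n. g n \<noteq> 0}"
  have "(\<Sum>n | g n mod p \<noteq> 0. g n mod p * a n) = (\<Sum>n\<in>?S. g n mod p * a n)"
    using assms by (intro sum.mono_neutral_left) auto
  moreover have "p dvd (\<Sum>n\<in>?S. g n mod p * a n - g n * a n)"
  proof (rule dvd_sum)
    fix n
    have "p dvd (g n mod p - g n) * a n" by (simp add: mod_eq_dvd_iff[symmetric])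
    then show "p dvd g n mod p * a n - g n * a n" by (simp add: left_diff_distrib)
  qed
  ultimately show ?thesis
    unfolding chr_eq_cis_sum cis_frac_eq_iff[OF assms(1)] by (simp add: sum_subtractf)
qed

text \<open>Exchanging the two sums moves the automaton from the configuration to the index; the
  reduction inside \<open>lca\<close> changes the exponent by a multiple of \<open>p\<close>
  only.\<close>

lemma chr_lca:
  assumes "p > 0" "finite U" "finite {n. g n \<noteq> 0}"
  shows "chr p g (lca p U f a) = chr p (lca_dual U f g) a"
proof -
  let ?S = "{n. g n \<noteq> 0}"
  have "(\<Sum>m | lca_dual U f g m \<noteq> 0. lca_dual U f g m * a m) = (\<Sum>u\<in>U. \<Sum>n\<in>?S. f u * g n * a (u + n))"
    using assms by (intro sum_lca_dual) (auto simp: algebra_simps)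
  also have "\<dots> = (\<Sum>n\<in>?S. \<Sum>u\<in>U. f u * g n * a (u + n))"
    by (rule sum.swap)
  also have "\<dots> = (\<Sum>n\<in>?S. g n * (\<Sum>u\<in>U. f u * a (u + n)))"
    by (simp add: sum_distrib_left mult_ac)
  finally have eq: "(\<Sum>m | lca_dual U f g m \<noteq> 0. lca_dual U f g m * a m) = \<dots>" .
  have "p dvd (\<Sum>n\<in>?S. g n * ((\<Sum>u\<in>U. f u * a (u + n)) mod p) - g n * (\<Sum>u\<in>U. f u * a (u + n)))"
  proof (rule dvd_sum)
    fix n
    let ?x = "\<Sum>u\<in>U. f u * a (u + n)"
    have "p dvd g n * (?x mod p - ?x)" by (simp add: mod_eq_dvd_iff[symmetric])
    then show "p dvd g n * (?x mod p) - g n * ?x" by (simp add: right_diff_distrib)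
  qed
  then show ?thesis
    unfolding chr_eq_cis_sum cis_frac_eq_iff[OF assms(1)] eq by (simp add: sum_subtractf lca_def)
qed

lemma chr_lca_funpow:
  assumes "p > 0" "finite U" "finite {n. c n \<noteq> 0}"
  shows "chr p c ((lca p U f ^^ j) a) = chr p ((lca_dual U f ^^ j) c) a"
  using assms
proof (induction j arbitrary: a)
  case (Suc j)
  have "chr p c ((lca p U f ^^ Suc j) a) = chr p c ((lca p U f ^^ j) (lca p U f a))"
    \<comment> \<open>The innermost application is peeled off: after the induction hypothesis it
      acts directly under the character, as \<open>chr_lca\<close> requires.\<close>
    by (simp add: funpow_swap1)
  also have "\<dots> = chr p ((lca_dual U f ^^ j) c) (lca p U f a)" using Suc by simp
  also have "\<dots> = chr p (lca_dual U f ((lca_dual U f ^^ j) c)) a"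
    using Suc.prems by (intro chr_lca finite_support_lca_dual_funpow)
  finally show ?case by simp
qed simp

text \<open>The configuration with a single 1 at \<open>m\<close> reads off the index at
  \<open>m\<close>. This uniqueness gives the description in \<open>char_index\<close> its
  meaning.\<close>

lemma chr_inj:
  fixes c c' :: "(int^'d) \<Rightarrow> int"
  assumes p: "p > 1" and c: "c \<in> char_coeffs p" "c' \<in> char_coeffs p"
    and eq: "\<And>a. a \<in> configs p \<Longrightarrow> chr p c a = chr p c' a"
  shows "c = c'"
proof
  fix m :: "int^'d"
  let ?a = "\<lambda>n. if n = m then 1 else 0 :: int"
  have sum: "(\<Sum>n | g n \<noteq> 0. g n * ?a n) = g m" if "g \<in> char_coeffs p" for g
  proof -
    have "(\<Sum>n | g n \<noteq> 0. g n * ?a n) = (\<Sum>n | g n \<noteq> 0. if n = m then g n else 0)"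
      by (intro sum.cong) auto
    then show ?thesis using that by (simp add: char_coeffs_def)
  qed
  have "?a \<in> configs p" using p by (simp add: configs_def)
  then have "p dvd c m - c' m"
    using eq[of ?a] p cis_frac_eq_iff[of p "c m" "c' m"] by (simp add: chr_eq_cis_sum sum c)
  then have "c m mod p = c' m mod p" by (simp add: mod_eq_dvd_iff)
  then show "c m = c' m" using c by (simp add: char_coeffs_def)
qed

lemma char_rank_chr:
  assumes p: "p > 1" and g: "finite {n. g n \<noteq> 0}"
  shows "char_rank p (chr p g) = card {n. \<not> p dvd g n}"
proof -
  let ?c = "\<lambda>n. g n mod p"
  have c: "?c \<in> char_coeffs p"
    unfolding char_coeffs_def using p by (auto intro!: finite_subset[OF _ g])
  have "char_index p (chr p g) = ?c"
    unfolding char_index_def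
  proof (rule the_equality)
    show "?c \<in> char_coeffs p \<and> (\<forall>a\<in>configs p. chr p g a = chr p ?c a)"
      using c p g by (simp add: chr_cong_mod)
  next
    fix c' assume "c' \<in> char_coeffs p \<and> (\<forall>a\<in>configs p. chr p g a = chr p c' a)"
    then show "c' = ?c" using c p g by (intro chr_inj[OF p]) (auto simp: chr_cong_mod)
  qed
  then show ?thesis by (simp add: char_rank_def dvd_eq_mod_eq_0)
qed

subsection \<open>Projection to one dimension\<close>

text \<open>Use the coordinates of a vector as coefficients of a polynomial and evaluate at an
  integer \<open>t\<close>: this is additive, and \<open>t\<close> need only avoid the finitely many
  roots belonging to nonzero differences in \<open>S\<close>.\<close>

lemma ex_additive_inj_on:
  fixes S :: "(int^'d) set"
  assumes "finite S"
  obtains \<phi> :: "int^'d \<Rightarrow> int" where "\<And>x y. \<phi> (x + y) = \<phi> x + \<phi> y" "inj_on \<phi> S"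
proof -
  obtain h :: "'d \<Rightarrow> nat" where h: "inj h"
    using finite_imp_inj_to_nat_seg[of "UNIV :: 'd set"] by auto
  define Q where "Q v = (\<Sum>i\<in>UNIV. monom (v $ i) (h i))" for v :: "int^'d"
  have Q: "Q v \<noteq> 0" if "v \<noteq> 0" for v
  proof -
    obtain i where i: "v $ i \<noteq> 0" using \<open>v \<noteq> 0\<close> by (auto simp: vec_eq_iff)
    have "coeff (Q v) (h i) = (\<Sum>k\<in>UNIV. if k = i then v $ k else 0)"
      unfolding Q_def coeff_sum by (intro sum.cong) (auto simp: injD[OF h])
    then have "coeff (Q v) (h i) \<noteq> 0" using i by simp
    then show ?thesis by auto
  qed
  define V where "V = {v \<in> (\<lambda>(x, y). x - y) ` (S \<times> S). v \<noteq> 0}"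
  have "finite (\<Union>v\<in>V. {t. poly (Q v) t = 0})"
    using assms by (auto simp: V_def Q poly_roots_finite)
  then obtain t where t: "t \<notin> (\<Union>v\<in>V. {t. poly (Q v) t = 0})"
    using ex_new_if_finite[OF infinite_UNIV_int] by blast
  show thesis
  proof (rule that[of "\<lambda>v. poly (Q v) t"])
    show add: "poly (Q (x + y)) t = poly (Q x) t + poly (Q y) t" for x y
      by (simp add: Q_def add_monom[symmetric] sum.distrib)
    show "inj_on (\<lambda>v. poly (Q v) t) S"
    proof (rule inj_onI, rule ccontr)
      fix x y assume xy: "x \<in> S" "y \<in> S" "poly (Q x) t = poly (Q y) t" "x \<noteq> y"
      then have "x - y \<in> V" by (force simp: V_def)
      then have "poly (Q (x - y)) t \<noteq> 0" using t by auto
      then show False using add[of "x - y" y] xy by simp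
    qed
  qed
qed

text \<open>The shift \<open>K\<close> turns a Laurent polynomial into an ordinary one; it has to
  make all exponents nonnegative, as \<open>nat\<close> would otherwise collapse them to 0.\<close>

definition proj_poly :: "((int^'d) \<Rightarrow> int) \<Rightarrow> int \<Rightarrow> ((int^'d) \<Rightarrow> int) \<Rightarrow> int poly" where
  "proj_poly \<phi> K g = (\<Sum>n | g n \<noteq> 0. monom (g n) (nat (\<phi> n + K)))"

text \<open>Merging sites may cancel terms but creates none: a coefficient prime to \<open>p\<close>
  needs a summand prime to \<open>p\<close>. This covers iterates, whose supports outgrow the set
  where \<open>\<phi>\<close> is injective.\<close>

lemma weight_mod_proj_poly_le:
  assumes fin: "finite {n. g n \<noteq> 0}"
  shows "weight_mod p (proj_poly \<phi> K g) \<le> card {n. \<not> int p dvd g n}"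
proof -
  let ?A = "{n. \<not> int p dvd g n}"
  have A: "finite ?A" by (rule finite_subset[OF _ fin]) auto
  have "{i. \<not> int p dvd coeff (proj_poly \<phi> K g) i} \<subseteq> (\<lambda>n. nat (\<phi> n + K)) ` ?A"
  proof (rule subsetI, rule ccontr)
    fix i assume i: "i \<in> {i. \<not> int p dvd coeff (proj_poly \<phi> K g) i}"
      and ni: "i \<notin> (\<lambda>n. nat (\<phi> n + K)) ` ?A"
    have "int p dvd coeff (proj_poly \<phi> K g) i"
      unfolding proj_poly_def coeff_sum using ni by (intro dvd_sum) auto
    with i show False by simp
  qed
  then have "card {i. \<not> int p dvd coeff (proj_poly \<phi> K g) i} \<le> card ?A"
    using A by (meson card_image_le card_mono finite_imageI order_trans)
  then show ?thesis by (simp add: weight_mod_def)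
qed

lemma coeff_proj_poly:
  assumes fin: "finite {n. g n \<noteq> 0}" and inj: "inj_on \<phi> {n. g n \<noteq> 0}"
    and K: "\<And>n. g n \<noteq> 0 \<Longrightarrow> 0 \<le> \<phi> n + K" and m: "g m \<noteq> 0"
  shows "coeff (proj_poly \<phi> K g) (nat (\<phi> m + K)) = g m"
proof -
  have "nat (\<phi> n + K) = nat (\<phi> m + K) \<longleftrightarrow> n = m" if "g n \<noteq> 0" for n
    using K[OF that] K[OF m] inj that m by (auto simp: eq_nat_nat_iff inj_on_def)
  then have "coeff (proj_poly \<phi> K g) (nat (\<phi> m + K)) = (\<Sum>n | g n \<noteq> 0. if n = m then g n else 0)"
    unfolding proj_poly_def coeff_sum by (intro sum.cong) auto
  then show ?thesis using fin m by simp
qed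

text \<open>Additivity of \<open>\<phi>\<close> turns convolution into multiplication, and the
  shifts add. Outside \<open>U\<close> the values of \<open>f\<close> are arbitrary, hence the
  cut-off.\<close>

lemma proj_poly_lca_dual:
  assumes fin: "finite U" "finite {n. g n \<noteq> 0}"
    and add: "\<And>x y. \<phi> (x + y) = \<phi> x + \<phi> y"
    and K: "\<And>n. g n \<noteq> 0 \<Longrightarrow> 0 \<le> \<phi> n + K" and K': "\<And>u. u \<in> U \<Longrightarrow> 0 \<le> \<phi> u + K'"
  shows "proj_poly \<phi> (K + K') (lca_dual U f g)
    = proj_poly \<phi> K g * proj_poly \<phi> K' (\<lambda>u. if u \<in> U then f u else 0)"
proof -
  let ?S = "{n. g n \<noteq> 0}"
  have "proj_poly \<phi> (K + K') (lca_dual U f g)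
      = (\<Sum>u\<in>U. \<Sum>n\<in>?S. monom (f u * g n) (nat (\<phi> (u + n) + (K + K'))))"
    unfolding proj_poly_def using fin by (intro sum_lca_dual) (auto simp: add_monom)
  also have "\<dots> = (\<Sum>u\<in>U. \<Sum>n\<in>?S. monom (f u) (nat (\<phi> u + K')) * monom (g n) (nat (\<phi> n + K)))"
  proof (intro sum.cong refl)
    fix u n assume "u \<in> U" "n \<in> ?S"
    then have "nat (\<phi> (u + n) + (K + K')) = nat (\<phi> u + K') + nat (\<phi> n + K)"
      using K[of n] K'[of u] by (simp add: add nat_add_distrib[symmetric] algebra_simps)
    then show "monom (f u * g n) (nat (\<phi> (u + n) + (K + K')))
        = monom (f u) (nat (\<phi> u + K')) * monom (g n) (nat (\<phi> n + K))"
      by (simp add: mult_monom)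
  qed
  also have "\<dots> = (\<Sum>u\<in>U. monom (f u) (nat (\<phi> u + K'))) * proj_poly \<phi> K g"
    by (simp add: proj_poly_def sum_product)
  also have "(\<Sum>u\<in>U. monom (f u) (nat (\<phi> u + K'))) = proj_poly \<phi> K' (\<lambda>u. if u \<in> U then f u else 0)"
    unfolding proj_poly_def using fin by (intro sum.mono_neutral_cong_right) auto
  finally show ?thesis by (simp add: mult.commute)
qed

lemma proj_poly_lca_dual_funpow:
  assumes fin: "finite U" "finite {n. c n \<noteq> 0}"
    and add: "\<And>x y. \<phi> (x + y) = \<phi> x + \<phi> y"
    and K: "\<And>n. c n \<noteq> 0 \<Longrightarrow> 0 \<le> \<phi> n + K" and K': "\<And>u. u \<in> U \<Longrightarrow> 0 \<le> \<phi> u + K'"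
  shows "proj_poly \<phi> (K + int j * K') ((lca_dual U f ^^ j) c)
    = proj_poly \<phi> K c * proj_poly \<phi> K' (\<lambda>u. if u \<in> U then f u else 0) ^ j"
proof -
  \<comment> \<open>Each site of the iterate is a site of \<open>c\<close> plus \<open>j\<close>
    elements of \<open>U\<close>, so this shift suffices.\<close>
  have nonneg: "0 \<le> \<phi> n + (K + int j * K')" if "(lca_dual U f ^^ j) c n \<noteq> 0" for j n
    using that
  proof (induction j arbitrary: n)
    case (Suc j)
    then have "n \<in> (\<lambda>(u, n). u + n) ` (U \<times> {n. (lca_dual U f ^^ j) c n \<noteq> 0})"
      by (intro subsetD[OF lca_dual_support_subset]) simp
    then obtain u k where "n = u + k" "u \<in> U" "(lca_dual U f ^^ j) c k \<noteq> 0" by auto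
    then show ?case using Suc.IH[of k] K'[of u] by (simp add: add algebra_simps)
  qed (use K in simp)
  show ?thesis
  proof (induction j)
    case (Suc j)
    have "proj_poly \<phi> (K + int (Suc j) * K') ((lca_dual U f ^^ Suc j) c)
        = proj_poly \<phi> ((K + int j * K') + K') (lca_dual U f ((lca_dual U f ^^ j) c))"
      by (simp add: algebra_simps)
    also have "\<dots> = proj_poly \<phi> (K + int j * K') ((lca_dual U f ^^ j) c)
        * proj_poly \<phi> K' (\<lambda>u. if u \<in> U then f u else 0)"
      using fin add K' by (intro proj_poly_lca_dual nonneg finite_support_lca_dual_funpow)
    finally show ?case using Suc by (simp add: mult_ac)
  qed simp
qed

lemma ex_shift_nonneg:
  fixes \<phi> :: "'a \<Rightarrow> int"
  assumes "finite S"
  obtains K where "\<And>n. n \<in> S \<Longrightarrow> 0 \<le> \<phi> n + K"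
proof (rule that)
  fix n assume "n \<in> S"
  then have "\<bar>\<phi> n\<bar> \<le> (\<Sum>n\<in>S. \<bar>\<phi> n\<bar>)" using assms by (intro member_le_sum) auto
  then show "0 \<le> \<phi> n + (\<Sum>n\<in>S. \<bar>\<phi> n\<bar>)" by linarith
qed

section \<open>A lower bound for the rank of the iterates\<close>

lemma ex_base_rank_ge:
  fixes p :: nat and U :: "(int^'d) set"
  assumes p: "prime p" and U: "finite U" and nt: "nontrivial_lca (int p) U f"
    and c: "c \<in> char_coeffs (int p)" "c \<noteq> (\<lambda>_. 0)"
  obtains q where "q \<ge> 2"
    "\<And>j. 2 ^ ones_digits q j \<le> char_rank (int p) (\<lambda>a. chr (int p) c ((lca (int p) U f ^^ j) a))"
proof -
  let ?f = "\<lambda>u. if u \<in> U then f u else 0"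
  let ?S = "{n. c n \<noteq> 0}"
  have S: "finite ?S" and cr: "c n \<in> {0..<int p}" for n using c by (auto simp: char_coeffs_def)
  have p2: "p \<ge> 2" using p by (simp add: prime_ge_2_nat)
  obtain \<phi> :: "int^'d \<Rightarrow> int" where add: "\<And>x y. \<phi> (x + y) = \<phi> x + \<phi> y"
    and inj: "inj_on \<phi> (U \<union> ?S)"
    using ex_additive_inj_on[OF finite_UnI[OF U S]] by blast
  obtain K where K: "\<And>n. n \<in> ?S \<Longrightarrow> 0 \<le> \<phi> n + K" using ex_shift_nonneg[OF S, of \<phi>] by blast
  obtain K' where K': "\<And>u. u \<in> U \<Longrightarrow> 0 \<le> \<phi> u + K'" using ex_shift_nonneg[OF U, of \<phi>] by blast
  define C F where "C = proj_poly \<phi> K c" and "F = proj_poly \<phi> K' ?f"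
  have not_dvd: "\<not> int p dvd x" if "x \<in> {0..<int p}" "x \<noteq> 0" for x
    by (rule zdvd_not_zless) (use that in auto)
  have supp: "{n. ?f n \<noteq> 0} \<subseteq> U" by auto
  obtain m where m: "c m \<noteq> 0" using c by auto
  have "coeff C (nat (\<phi> m + K)) = c m"
    unfolding C_def
  proof (rule coeff_proj_poly[OF S _ _ m])
    show "inj_on \<phi> ?S" by (rule inj_on_subset[OF inj]) simp
  qed (use K in simp)
  then have "\<not> int p dvd coeff C (nat (\<phi> m + K))" using not_dvd[OF cr m] by simp
  then have C1: "\<exists>i. \<not> int p dvd coeff C i" ..
  have F2: "weight_mod p F \<ge> 2"
  proof -
    let ?A = "{u\<in>U. f u mod int p \<noteq> 0}"
    have "2 \<le> card ?A" using nt by (simp add: nontrivial_lca_def)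
    also have "\<dots> \<le> card {i. \<not> int p dvd coeff F i}"
    proof (rule card_inj_on_le[OF _ _ finite_coeff_not_dvd])
      show "inj_on (\<lambda>u. nat (\<phi> u + K')) ?A"
      proof (rule inj_onI)
        fix u v assume "u \<in> ?A" "v \<in> ?A" "nat (\<phi> u + K') = nat (\<phi> v + K')"
        then have "u \<in> U" "v \<in> U" "\<phi> u = \<phi> v" using K'[of u] K'[of v] by auto
        then show "u = v" using inj by (auto dest: inj_onD)
      qed
      show "(\<lambda>u. nat (\<phi> u + K')) ` ?A \<subseteq> {i. \<not> int p dvd coeff F i}"
      proof clarify
        fix u assume u: "u \<in> U" "f u mod int p \<noteq> 0" "int p dvd coeff F (nat (\<phi> u + K'))"
        have "coeff F (nat (\<phi> u + K')) = ?f u"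
          unfolding F_def
        proof (rule coeff_proj_poly)
          show "finite {n. ?f n \<noteq> 0}" by (rule finite_subset[OF supp U])
          show "inj_on \<phi> {n. ?f n \<noteq> 0}" by (rule inj_on_subset[OF inj]) (use supp in blast)
          show "0 \<le> \<phi> n + K'" if "?f n \<noteq> 0" for n
            using K'[of n] that by (cases "n \<in> U") simp_all
          show "?f u \<noteq> 0" using u by auto
        qed
        with u show False by (simp add: dvd_eq_mod_eq_0)
      qed
    qed
    finally show ?thesis by (simp add: weight_mod_def)
  qed
  define e where "e = max (degree F) (degree C)"
  \<comment> \<open>With this exponent \<open>p ^ L \<ge> 2 ^ L > 2 * e + 1\<close>, which yields
    both size conditions on the base.\<close>
  define L where "L = 2 * e + 1"
  have "L < 2 ^ L" by (rule less_exp)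
  also have "(2::nat) ^ L \<le> p ^ L" using p2 by (rule power_mono) simp
  finally have L: "L < p ^ L" .
  have q: "2 * e < p ^ L" "p ^ L \<ge> 2" using L unfolding L_def by linarith+
  show thesis
  proof (rule that[of "p ^ L"])
    fix j
    let ?g = "(lca_dual U f ^^ j) c"
    have g: "finite {n. ?g n \<noteq> 0}" by (rule finite_support_lca_dual_funpow[OF U S])
    have "2 ^ ones_digits (p ^ L) j \<le> weight_mod p (C * F ^ j)"
      by (rule weight_mod_mult_power_ge[OF p refl F2 _ q C1]) (simp_all add: e_def)
    also have "C * F ^ j = proj_poly \<phi> (K + int j * K') ?g"
      unfolding C_def F_def
      by (rule proj_poly_lca_dual_funpow[OF U S add, symmetric]) (use K K' in simp_all)
    also have "weight_mod p \<dots> \<le> card {n. \<not> int p dvd ?g n}"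
      by (rule weight_mod_proj_poly_le[OF g])
    also have "\<dots> = char_rank (int p) (chr (int p) ?g)"
      using p2 g by (simp add: char_rank_chr)
    also have "chr (int p) ?g = (\<lambda>a. chr (int p) c ((lca (int p) U f ^^ j) a))"
      using p2 by (simp add: chr_lca_funpow[OF _ U S])
    finally show "2 ^ ones_digits (p ^ L) j \<le> char_rank (int p) (\<lambda>a. chr (int p) c ((lca (int p) U f ^^ j) a))" .
  qed (rule q)
qed

theorem theorem5p1:
  fixes p :: int and U :: "(int^'d) set" and f :: "(int^'d) \<Rightarrow> int"
  assumes "prime p"
    and "finite U"
    and "\<forall>u\<in>U. f u \<in> {0..<p}"
    and "nontrivial_lca p U f"
  shows "diffusive_in_density p (lca p U f)"
  unfolding diffusive_in_density_def
proof (intro ballI impI)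
  fix c :: "(int^'d) \<Rightarrow> int" assume c: "c \<in> char_coeffs p" "c \<noteq> (\<lambda>_. 0)"
  let ?rank = "\<lambda>j. char_rank p (\<lambda>a. chr p c ((lca p U f ^^ j) a))"
  obtain n where n: "p = int n" "prime n"
    using assms(1) by (metis nonneg_int_cases prime_ge_0_int prime_int_nat_transfer nat_int)
  obtain q where q: "q \<ge> 2" "\<And>j. 2 ^ ones_digits q j \<le> ?rank j"
    using ex_base_rank_ge[OF n(2) assms(2) assms(4)[unfolded n(1)] c[unfolded n(1)], folded n(1)]
    by blast
  obtain J where J: "(\<lambda>N. real (card (J \<inter> {1..N})) / real N) \<longlonglongrightarrow> 1"
    "\<And>M. \<exists>j0. \<forall>j\<in>J. j \<ge> j0 \<longrightarrow> ones_digits q j \<ge> M"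
    using density_one_set_tendsto_infinity[OF ones_digits_less_density_zero[OF q(1)]] by blast
  show "\<exists>J. (\<lambda>N. real (card (J \<inter> {1..N})) / real N) \<longlonglongrightarrow> 1 \<and>
      (\<forall>M. \<exists>j0. \<forall>j\<in>J. j \<ge> j0 \<longrightarrow> ?rank j \<ge> M)"
  proof (intro exI[of _ J] conjI J(1) allI)
    fix M
    obtain j0 where j0: "\<forall>j\<in>J. j \<ge> j0 \<longrightarrow> ones_digits q j \<ge> M" using J(2) by blast
    have "?rank j \<ge> M" if "j \<in> J" "j \<ge> j0" for j
    proof -
      have "M \<le> ones_digits q j" using j0 that by blast
      \<comment> \<open>The crude bound \<open>v < 2 ^ v\<close> suffices, since only divergence of
        the rank is claimed.\<close>
      also have "\<dots> \<le> 2 ^ ones_digits q j" by (intro less_imp_le less_exp)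
      also have "\<dots> \<le> ?rank j" by (rule q(2))
      finally show ?thesis .
    qed
    then show "\<exists>j0. \<forall>j\<in>J. j \<ge> j0 \<longrightarrow> ?rank j \<ge> M" by blast
  qed
qed

end
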